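(* Let $V$ be a real vector space with linear dual $V^{\#}$, and let $f_1,f_2\colon V\to\overline{\mathbb{R}}$ be lower semicontinuous, convex functions, in the sense that $f_1=f_1^{\star\star}$ and $f_2=f_2^{\star\star}$. Then $$\sup_{x\in V}\{f_2(x)-f_1(x)\}=\sup_{k\in V^{\#}}\{f_1^{\star}(k)-f_2^{\star}(k)\}.$$
   Context: $\overline{\mathbb{R}}=[-\infty,+\infty]$. Addition on $\overline{\mathbb{R}}$ extends that of $\mathbb{R}$ by $(+\infty)+y=y+(+\infty)=+\infty$ for all $y\in\overline{\mathbb{R}}$ (including $y=-\infty$) and $(-\infty)+y=y+(-\infty)=-\infty$ for all $y<+\infty$. Subtraction on $\overline{\mathbb{R}}$ is defined by $c-b:=\inf\{a\in\overline{\mathbb{R}}\mid a+b\ge c\}$. Thus it is the usual subtraction on finite values; $c-(+\infty)=-\infty$ for every $c$; $(-\infty)-b=-\infty$ for every $b$; $c-(-\infty)=+\infty$ for every $c>-\infty$; $(+\infty)-b=+\infty$ for every $b<+\infty$. In particular $(+\infty)-(+\infty)=-\infty=(-\infty)-(-\infty)$. For $x\in V$ and $k\in V^{\#}$ write $\langle x,k\rangle:=k(x)\in\mathbb{R}$. For $f\colon V\to\overline{\mathbb{R}}$ and $g\colon V^{\#}\to\overline{\mathbb{R}}$ the Legendre-Fenchel transform and its reverse are $$f^{\star}(k):=\sup_{x\in V}\{\langle x,k\rangle-f(x)\},\qquad g^{\star}(x):=\sup_{k\in V^{\#}}\{\langle x,k\rangle-g(k)\},$$ and $f^{\star\star}:=(f^{\star})^{\star}\colon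 V\to\overline{\mathbb{R}}$. The lower semicontinuous, convex functions on $V$ are by convention the functions fixed by the closure operation $f\mapsto f^{\star\star}$, equivalently the pointwise suprema of (possibly empty) families of functions $x\mapsto\langle x,k\rangle+a$ with $k\in V^{\#}$ and $a\in\mathbb{R}$. *)

theory Defs
  imports "HOL-Library.Extended_Real"
begin

text \<open>
  Addition on \<^typ>\<open>ereal\<close> is already the upper addition
  (\<open>\<infinity> + - \<infinity> = - \<infinity> + \<infinity> = \<infinity>\<close>). The library subtraction \<open>c - b = c + - b\<close>, however, has
  \<open>\<infinity> - \<infinity> = - \<infinity> - (- \<infinity>) = \<infinity>\<close>, so subtraction is defined here as the residual of addition,
  which gives \<open>- \<infinity>\<close> in both cases.
\<close>

definition ereal_residual :: "ereal \<Rightarrow> ereal \<Rightarrow> ereal" (infixl "\<ominus>" 65)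
  where "c \<ominus> b = Inf {a. a + b \<ge> c}"

lemma upper_addition:
  "(\<infinity>::ereal) + y = \<infinity>" "y + (\<infinity>::ereal) = \<infinity>"
  "y < \<infinity> \<Longrightarrow> - \<infinity> + y = (- \<infinity>::ereal)" "y < \<infinity> \<Longrightarrow> y + - \<infinity> = (- \<infinity>::ereal)"
  by (cases y; simp)+

lemma ereal_residual_real: "ereal c \<ominus> ereal b = ereal (c - b)"
proof -
  have "{a. a + ereal b \<ge> ereal c} = {ereal (c - b)..}"
  proof (rule set_eqI)
    fix a show "a \<in> {a. a + ereal b \<ge> ereal c} \<longleftrightarrow> a \<in> {ereal (c - b)..}"
      by (cases a) auto
  qed
  then show ?thesis by (simp add: ereal_residual_def)
qed

lemma ereal_residual_infty:
  "c \<ominus> \<infinity> = - \<infinity>"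
  "- \<infinity> \<ominus> b = - \<infinity>"
  "c > - \<infinity> \<Longrightarrow> c \<ominus> - \<infinity> = \<infinity>"
  "b < \<infinity> \<Longrightarrow> \<infinity> \<ominus> b = \<infinity>"
proof -
  show "c \<ominus> \<infinity> = - \<infinity>" "- \<infinity> \<ominus> b = - \<infinity>"
    by (simp_all add: ereal_residual_def bot_ereal_def[symmetric])
  show "c \<ominus> - \<infinity> = \<infinity>" if "c > - \<infinity>"
  proof -
    have "{a. a + - \<infinity> \<ge> c} = {\<infinity>}"
    proof (rule set_eqI)
      fix a show "a \<in> {a. a + - \<infinity> \<ge> c} \<longleftrightarrow> a \<in> {\<infinity>}"
        using that by (cases a) auto
    qed
    then show ?thesis by (simp add: ereal_residual_def)
  qed
  show "\<infinity> \<ominus> b = \<infinity>" if "b < \<infinity>"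
  proof -
    have "{a. a + b \<ge> \<infinity>} = {\<infinity>}"
    proof (rule set_eqI)
      fix a show "a \<in> {a. a + b \<ge> \<infinity>} \<longleftrightarrow> a \<in> {\<infinity>}"
        using that by (cases a; cases b) auto
    qed
    then show ?thesis by (simp add: ereal_residual_def)
  qed
qed

definition algebraic_dual :: "('a::real_vector \<Rightarrow> real) set"
  where "algebraic_dual = {k. linear k}"

definition fenchel_transform :: "('a::real_vector \<Rightarrow> ereal) \<Rightarrow> ('a \<Rightarrow> real) \<Rightarrow> ereal"
  where "fenchel_transform f k = (SUP x. ereal (k x) \<ominus> f x)"

text \<open>
  Functions on the dual are represented by functions on all of \<^typ>\<open>'a \<Rightarrow> real\<close>; only
  their values on linear functionals are used.
\<close>

definition reverse_fenchel_transform :: "(('a::real_vector \<Rightarrow> real) \<Rightarrow> ereal) \<Rightarrow> 'a \<Rightarrow> ereal"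
  where "reverse_fenchel_transform g x = (SUP k\<in>algebraic_dual. ereal (k x) \<ominus> g k)"

definition lsc_convex :: "('a::real_vector \<Rightarrow> ereal) \<Rightarrow> bool"
  where "lsc_convex f \<longleftrightarrow> f = reverse_fenchel_transform (fenchel_transform f)"

end

theory Submission imports Defs begin

text \<open>
  Subtraction is the residual of addition: \<open>c \<ominus> b \<le> a\<close> iff \<open>c \<le> a + b\<close>. Unfolding the suprema with this
  adjunction turns each bound \<open>\<le> s\<close> on either side into inequalities between sums, and the Fenchel-Young
  inequality \<open>k x \<le> f\<^sup>\<star> k + f x\<close> passes from one to the other. Both sides thus have the same upper bounds.
\<close>

text \<open>The infimum defining \<open>c \<ominus> b\<close> is attained:
  \<open>(c \<ominus> b) + b\<close> is still at least \<open>c\<close>. For infinite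
  \<open>b\<close> this rests on upper addition, where
  \<open>- \<infinity> + \<infinity> = \<infinity>\<close>.\<close>

lemma ereal_residual_le_iff: "c \<ominus> b \<le> a \<longleftrightarrow> c \<le> a + b"
proof
  assume "c \<ominus> b \<le> a"
  moreover have "c \<le> (c \<ominus> b) + b"
    by (cases c; cases b) (simp_all add: ereal_residual_real ereal_residual_infty)
  ultimately show "c \<le> a + b"
    by (meson add_right_mono order_trans)
next
  assume "c \<le> a + b"
  then show "c \<ominus> b \<le> a"
    unfolding ereal_residual_def by (intro Inf_lower) simp
qed

lemma fenchel_transform_le_iff:
  "fenchel_transform f k \<le> a \<longleftrightarrow> (\<forall>x. ereal (k x) \<le> a + f x)"
  by (simp add: fenchel_transform_def SUP_le_iff ereal_residual_le_iff)

lemma reverse_fenchel_transform_le_iff: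
  "reverse_fenchel_transform g x \<le> a \<longleftrightarrow> (\<forall>k\<in>algebraic_dual. ereal (k x) \<le> a + g k)"
  by (simp add: reverse_fenchel_transform_def SUP_le_iff ereal_residual_le_iff)

lemma fenchel_young: "ereal (k x) \<le> fenchel_transform f k + f x"
  using fenchel_transform_le_iff by blast

theorem theorem5:
  fixes f\<^sub>1 f\<^sub>2 :: "'a::real_vector \<Rightarrow> ereal"
  assumes "lsc_convex f\<^sub>1" and "lsc_convex f\<^sub>2"
  shows "(SUP x. f\<^sub>2 x \<ominus> f\<^sub>1 x)
    = (SUP k\<in>algebraic_dual. fenchel_transform f\<^sub>1 k \<ominus> fenchel_transform f\<^sub>2 k)"
proof -
  have "(\<forall>x. f\<^sub>2 x \<le> s + f\<^sub>1 x) \<longleftrightarrow>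
      (\<forall>k\<in>algebraic_dual. fenchel_transform f\<^sub>1 k \<le> s + fenchel_transform f\<^sub>2 k)" for s
  proof (intro iffI ballI allI)
    fix k assume bound: "\<forall>x. f\<^sub>2 x \<le> s + f\<^sub>1 x"
    \<comment> \<open>\<open>s + fenchel_transform f\<^sub>2 k\<close> does not depend on
      \<open>x\<close>, so it serves as the bound \<open>a\<close> in
      \<open>fenchel_transform_le_iff\<close> for \<open>f\<^sub>1\<close>.\<close>
    have "ereal (k x) \<le> s + fenchel_transform f\<^sub>2 k + f\<^sub>1 x" for x
    proof -
      have "ereal (k x) \<le> fenchel_transform f\<^sub>2 k + f\<^sub>2 x"
        by (rule fenchel_young)
      also have "\<dots> \<le> fenchel_transform f\<^sub>2 k + (s + f\<^sub>1 x)"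
        using bound by (intro add_left_mono) simp
      finally show ?thesis by (simp add: ac_simps)
    qed
    then show "fenchel_transform f\<^sub>1 k \<le> s + fenchel_transform f\<^sub>2 k"
      by (simp add: fenchel_transform_le_iff)
  next
    fix x assume bound: "\<forall>k\<in>algebraic_dual. fenchel_transform f\<^sub>1 k \<le> s + fenchel_transform f\<^sub>2 k"
    have "ereal (k x) \<le> s + f\<^sub>1 x + fenchel_transform f\<^sub>2 k" if "k \<in> algebraic_dual" for k
    proof -
      have "ereal (k x) \<le> fenchel_transform f\<^sub>1 k + f\<^sub>1 x"
        by (rule fenchel_young)
      also have "\<dots> \<le> s + fenchel_transform f\<^sub>2 k + f\<^sub>1 x"
        using bound that by (intro add_right_mono) simp
      finally show ?thesis by (simp add: ac_simps)
    qed
    \<comment> \<open>With \<open>x\<close> fixed and \<open>k\<close> varying, the bound is now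
      \<open>s + f\<^sub>1 x\<close>. It controls the biconjugate of \<open>f\<^sub>2\<close>, which
      closedness identifies with \<open>f\<^sub>2\<close>.\<close>
    then have "reverse_fenchel_transform (fenchel_transform f\<^sub>2) x \<le> s + f\<^sub>1 x"
      by (simp add: reverse_fenchel_transform_le_iff)
    then show "f\<^sub>2 x \<le> s + f\<^sub>1 x"
      using assms(2) unfolding lsc_convex_def by metis
  qed
  then have "(SUP x. f\<^sub>2 x \<ominus> f\<^sub>1 x) \<le> s \<longleftrightarrow>
      (SUP k\<in>algebraic_dual. fenchel_transform f\<^sub>1 k \<ominus> fenchel_transform f\<^sub>2 k) \<le> s" for s
    by (simp add: SUP_le_iff ereal_residual_le_iff)
  \<comment> \<open>Taking \<open>s\<close> to be each supremum in turn gives the two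
    inequalities.\<close>
  then show ?thesis by (meson order_antisym order_refl)
qed

end
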